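(* For $p\in[1,\infty]$, a one-sided non-adaptive $(\epsilon,\ell_p)$-tester for real symmetric $d\times d$ matrices must make at least $\Omega\!\left(\frac{1}{\epsilon^2}d^{2-2/p}\right)$ vector-matrix-vector queries.
   Context: For a real symmetric $d\times d$ matrix $A$, $\|A\|_p$ denotes the Schatten-$p$ norm (the $\ell_p$ norm of the vector of singular values; $\|A\|_\infty$ is the operator norm), and $\lambda_{\min}(A)$ is its smallest eigenvalue. PSD means positive semidefinite. The parameter $\epsilon$ satisfies $0<\epsilon<1$, and $1/p=0$ when $p=\infty$. In the vector-matrix-vector model an algorithm accesses an unknown real symmetric $d\times d$ matrix $A$ through queries in which it chooses a pair of vectors $(v,w)$ in $\mathbb{R}^d$ and receives $v^TAw$; it is non-adaptive if the queries do not depend on the answers to other queries. For $p\in[1,\infty]$, an $(\epsilon,\ell_p)$-tester is a (randomized) algorithm that makes such queries to $A$, outputs True with probability at least $2/3$ if $A$ is PSD, and outputs False with probability at least $2/3$ if $A$ is $\epsilon\|A\|_p$-far in spectral distance from the PSD cone, or equivalently if $\lambda_{\min}(A)\le-\epsilon\|A\|_p$. The tester is one-sided (has one-sided error) if it is guaranteed to output True on all PSD inputs, even if the input is generated by an adversary with access to the random coins of the tester. $\Omega(\cdot)$ is the standard asymptotic notation.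
   Formalization: As d² queries always suffice and the claim fails as ε→1 (e.g. 2<p<∞), the bound shown is Ω(min(d^{2-2/p}/ε², d²)) for ε≤ε₀, any fixed ε₀<1, with constant depending on ε₀; the zero matrix, which is PSD yet meets the farness inequality, is not counted as far. *)

theory Defs
  imports "HOL-Probability.Probability_Measure" "Jordan_Normal_Form.Spectral_Radius"
begin

definition sym_mat :: "nat \<Rightarrow> real mat \<Rightarrow> bool" where
  "sym_mat d A \<longleftrightarrow> A \<in> carrier_mat d d \<and> transpose_mat A = A"

definition psd_mat :: "nat \<Rightarrow> real mat \<Rightarrow> bool" where
  "psd_mat d A \<longleftrightarrow> sym_mat d A \<and> (\<forall>v \<in> carrier_vec d. scalar_prod v (A *\<^sub>v v) \<ge> 0)"

definition lambda_min :: "real mat \<Rightarrow> real" where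
  "lambda_min A = Min (spectrum A)"

text \<open>The multiset of singular values: square roots of the eigenvalues of \<open>A\<^sup>T A\<close>, counted with
  algebraic multiplicity. All roots of that characteristic polynomial are real, so a
  \<open>d \<times> d\<close> matrix has exactly \<open>d\<close> of them.\<close>

definition singular_values :: "real mat \<Rightarrow> real multiset" where
  "singular_values A = image_mset sqrt (proots (char_poly (transpose_mat A * A)))"

definition schatten_norm :: "ennreal \<Rightarrow> real mat \<Rightarrow> real" where
  "schatten_norm p A =
     (if p = \<infinity> then Max (set_mset (singular_values A))
      else (\<Sum>\<sigma>\<in>#singular_values A. \<sigma> powr enn2real p) powr (1 / enn2real p))"

definition recip_exponent :: "ennreal \<Rightarrow> real" where
  "recip_exponent p = (if p = \<infinity> then 0 else 1 / enn2real p)"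

text \<open>A non-adaptive algorithm with its random coins fixed: a list of query pairs, chosen
  before any answer is seen, and a decision rule applied to the list of answers.\<close>

datatype det_tester =
  DetTester (queries: "(real vec \<times> real vec) list") (decide: "real list \<Rightarrow> bool")

definition run_tester :: "det_tester \<Rightarrow> real mat \<Rightarrow> bool" where
  "run_tester T A = decide T (map (\<lambda>(v, w). scalar_prod v (A *\<^sub>v w)) (queries T))"

text \<open>A randomized non-adaptive algorithm is a probability space of deterministic ones. This is
  no restriction: any source of coins can be pushed forward to the type \<^typ>\<open>det_tester\<close>. A
  non-measurable set has measure \<open>0\<close>, so the bounds by \<open>2/3\<close> include the measurability of the
  events they concern.

  The zero matrix satisfies \<open>\<lambda>\<^sub>m\<^sub>i\<^sub>n \<le> -\<epsilon> \<parallel>A\<parallel>\<^sub>p\<close> with both sides \<open>0\<close>, although it is PSD. It is the only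
  PSD matrix that does, and without its exclusion no tester would exist.\<close>

definition nonadaptive_tester :: "nat \<Rightarrow> real \<Rightarrow> ennreal \<Rightarrow> det_tester measure \<Rightarrow> bool" where
  "nonadaptive_tester d \<epsilon> p M \<longleftrightarrow>
     prob_space M \<and>
     (\<forall>T \<in> space M. set (queries T) \<subseteq> carrier_vec d \<times> carrier_vec d) \<and>
     (\<forall>A. psd_mat d A \<longrightarrow> measure M {T \<in> space M. run_tester T A} \<ge> 2/3) \<and>
     (\<forall>A. sym_mat d A \<and> A \<noteq> 0\<^sub>m d d \<and> lambda_min A \<le> - \<epsilon> * schatten_norm p A \<longrightarrow>
        measure M {T \<in> space M. \<not> run_tester T A} \<ge> 2/3)"

text \<open>The adversary knows the coins: \<open>A\<close> may depend on \<open>T\<close>.\<close>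

definition one_sided :: "nat \<Rightarrow> det_tester measure \<Rightarrow> bool" where
  "one_sided d M \<longleftrightarrow> (\<forall>T \<in> space M. \<forall>A. psd_mat d A \<longrightarrow> run_tester T A)"

definition makes_at_most_queries :: "det_tester measure \<Rightarrow> nat \<Rightarrow> bool" where
  "makes_at_most_queries M q \<longleftrightarrow> (\<forall>T \<in> space M. length (queries T) \<le> q)"

end

(* On the random input A = I - b x x^T with x a uniform sign vector, the kernel of x x^T away from
   the diagonal is a chaos of order 2, so its projection onto the span of q queries has expected
   squared Frobenius norm at most 2 q. If this is below ((1 - b) / b)^2, subtracting only the
   projection gives a PSD matrix with the same answers, and a one-sided tester must accept. Choosing
   b d = 1 + epsilon d^(1/p) / (1 - epsilon_0) makes A far from PSD, which forces
   q to be of order 1 / b^2. *)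

theory Submission
  imports Defs
begin

text \<open>Since x_i^2 = 1, the diagonal of x x^T is fixed, and A = (1 - b) I - b Y with Y the
  off-diagonal part. Only Y is random, and it is all that the queries have to detect. One-sidedness
  lets the adversary see both the coins and x, so a single PSD matrix with the same answers already
  forces acceptance; no second distribution on PSD matrices has to be compared with the first.
  Replacing Y by its projection gives such a matrix once the Frobenius norm of b times the
  projection is at most 1 - b. The Frobenius norm is a crude bound for the operator norm, but its
  second moment is computable. The size of b comes from farness: lambda_min is 1 - b d and the
  Schatten norm is at most d^(1/p) + (b d - 1), so (1 - epsilon)(b d - 1) must be at least epsilon
  d^(1/p). Hence 1/b^2 has the order of d^2 / max(1, epsilon d^(1/p))^2, which is the minimum in the
  theorem. The cap d^2 cannot be avoided: d (d + 1) / 2 queries read off the whole matrix.\<close>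

lemma mult_mat_entries:
  assumes "i < n" "j < m"
  shows "(mat n k f * mat k m g) $$ (i, j) = (\<Sum>l<k. f (i, l) * g (l, j) :: 'a :: comm_semiring_0)"
  using assms by (simp add: scalar_prod_def atLeast0LessThan)

section \<open>Spectrum and Schatten norms of a multiple of the identity plus a rank-one
  matrix\<close>

definition rank_one_perturb :: "nat \<Rightarrow> real \<Rightarrow> real \<Rightarrow> (nat \<Rightarrow> real) \<Rightarrow> real mat" where
  "rank_one_perturb d \<alpha> \<beta> x = mat d d (\<lambda>(i, j). (if i = j then \<alpha> else 0) + \<beta> * x i * x j)"

lemma rank_one_perturb_carrier [simp]: "rank_one_perturb d \<alpha> \<beta> x \<in> carrier_mat d d"
  by (simp add: rank_one_perturb_def)

lemma transpose_rank_one_perturb [simp]: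
  "transpose_mat (rank_one_perturb d \<alpha> \<beta> x) = rank_one_perturb d \<alpha> \<beta> x"
  by (rule eq_matI) (auto simp: rank_one_perturb_def)

lemma sym_mat_rank_one_perturb: "sym_mat d (rank_one_perturb d \<alpha> \<beta> x)"
  by (simp add: sym_mat_def)

text \<open>The family is closed under squaring, so one characteristic polynomial yields both the
  eigenvalues and, through the product of the transpose with the matrix, the singular
  values.\<close>

lemma rank_one_perturb_square:
  "rank_one_perturb d \<alpha> \<beta> x * rank_one_perturb d \<alpha> \<beta> x
    = rank_one_perturb d (\<alpha>\<^sup>2) (2 * \<alpha> * \<beta> + \<beta>\<^sup>2 * (\<Sum>i<d. (x i)\<^sup>2)) x"
proof (rule eq_matI)
  fix i j
  assume "i < dim_row (rank_one_perturb d (\<alpha>\<^sup>2) (2 * \<alpha> * \<beta> + \<beta>\<^sup>2 * (\<Sum>i<d. (x i)\<^sup>2)) x)"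
    and "j < dim_col (rank_one_perturb d (\<alpha>\<^sup>2) (2 * \<alpha> * \<beta> + \<beta>\<^sup>2 * (\<Sum>i<d. (x i)\<^sup>2)) x)"
  then have ij: "i < d" "j < d" by (simp_all add: rank_one_perturb_def)
  have "(\<Sum>l<d. ((if i = l then \<alpha> else 0) + \<beta> * x i * x l) * ((if l = j then \<alpha> else 0) + \<beta> * x l * x j))
      = (\<Sum>l<d. (if l = i then (if i = j then \<alpha> * \<alpha> else 0) + \<alpha> * (\<beta> * x i * x j) else 0)
          + (if l = j then \<alpha> * (\<beta> * x i * x j) else 0) + \<beta>\<^sup>2 * x i * x j * (x l)\<^sup>2)"
    by (intro sum.cong) (auto simp: algebra_simps power2_eq_square)
  also have "\<dots> = (if i = j then \<alpha> * \<alpha> else 0) + \<alpha> * (\<beta> * x i * x j) + \<alpha> * (\<beta> * x i * x j)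
          + \<beta>\<^sup>2 * x i * x j * (\<Sum>l<d. (x l)\<^sup>2)"
    using ij by (simp add: sum.distrib sum_distrib_left)
  finally show "(rank_one_perturb d \<alpha> \<beta> x * rank_one_perturb d \<alpha> \<beta> x) $$ (i, j)
      = rank_one_perturb d (\<alpha>\<^sup>2) (2 * \<alpha> * \<beta> + \<beta>\<^sup>2 * (\<Sum>i<d. (x i)\<^sup>2)) x $$ (i, j)"
    using ij unfolding rank_one_perturb_def
    by (subst mult_mat_entries) (auto simp: algebra_simps power2_eq_square)
qed (simp_all add: rank_one_perturb_def)

text \<open>In the basis \<open>x, e\<^sub>1, \<dots>, e\<^bsub>d-1\<^esub>\<close> the matrix becomes upper triangular.\<close>

lemma char_poly_rank_one_perturb:
  assumes "0 < d" and x0: "x 0 \<noteq> 0"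
  shows "char_poly (rank_one_perturb d \<alpha> \<beta> x)
    = [:- (\<alpha> + \<beta> * (\<Sum>i<d. (x i)\<^sup>2)), 1:] * [:- \<alpha>, 1:] ^ (d - 1)"
proof -
  obtain n where d: "d = Suc n" using \<open>0 < d\<close> by (cases d) auto
  define \<mu> where "\<mu> = \<alpha> + \<beta> * (\<Sum>i<d. (x i)\<^sup>2)"
  define A where "A = rank_one_perturb d \<alpha> \<beta> x"
  define P where "P = mat d d (\<lambda>(i, j). if j = 0 then x i else if i = j then 1 else 0)"
  define Q where "Q = mat d d (\<lambda>(i, j).
    if j = 0 then if i = 0 then 1 / x 0 else - (x i / x 0) else if i = j then 1 else 0)"
  \<comment> \<open>The columns of \<open>P\<close> are x, e_1, ..., and \<open>P\<close> is
    invertible because \<open>x 0\<close> is nonzero. The matrix sends x to \<open>\<mu>\<close> x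
    and e_j to \<open>\<alpha>\<close> e_j + \<open>\<beta>\<close> x_j x; the last term is the
    first row of \<open>U\<close>.\<close>
  define U where "U = mat d d (\<lambda>(i, j).
    if i = j then if i = 0 then \<mu> else \<alpha> else if i = 0 then \<beta> * x j else 0)"
  note defs = A_def P_def Q_def U_def
  have carr: "A \<in> carrier_mat d d" "P \<in> carrier_mat d d" "Q \<in> carrier_mat d d" "U \<in> carrier_mat d d"
    by (simp_all add: defs)
  have PQ: "P * Q = 1\<^sub>m d"
  proof (rule eq_matI)
    fix i j assume "i < dim_row (1\<^sub>m d)" "j < dim_col (1\<^sub>m d)"
    then have ij: "i < d" "j < d" by simp_all
    have "(\<Sum>l<d. (if l = 0 then x i else if i = l then 1 else 0) *
         (if j = 0 then if l = 0 then 1 / x 0 else - (x l / x 0) else if l = j then 1 else 0))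
       = (\<Sum>l<d. (if l = 0 then if j = 0 then x i / x 0 else 0 else 0)
         + (if l = i then if i = 0 then 0 else if j = 0 then - (x i / x 0) else if i = j then 1 else 0 else 0))"
      by (intro sum.cong) auto
    also have "\<dots> = (if i = j then 1 else 0)"
      using ij x0 by (auto simp: sum.distrib)
    finally show "(P * Q) $$ (i, j) = 1\<^sub>m d $$ (i, j)"
      using ij unfolding P_def Q_def by (subst mult_mat_entries) auto
  qed (simp_all add: defs)
  have QP: "Q * P = 1\<^sub>m d" using mat_mult_left_right_inverse[OF carr(2,3) PQ] .
  have AP: "A * P = P * U"
  proof (rule eq_matI)
    fix i j assume "i < dim_row (P * U)" "j < dim_col (P * U)"
    then have ij: "i < d" "j < d" by (simp_all add: defs)
    have L: "(\<Sum>l<d. ((if i = l then \<alpha> else 0) + \<beta> * x i * x l) *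
         (if j = 0 then x l else if l = j then 1 else 0))
       = (if j = 0 then \<mu> * x i else (if i = j then \<alpha> else 0) + \<beta> * x i * x j)"
    proof (cases "j = 0")
      case True
      have "(\<Sum>l<d. ((if i = l then \<alpha> else 0) + \<beta> * x i * x l) * x l)
          = (\<Sum>l<d. (if l = i then \<alpha> * x i else 0) + \<beta> * x i * (x l)\<^sup>2)"
        by (intro sum.cong) (auto simp: algebra_simps power2_eq_square)
      also have "\<dots> = \<mu> * x i"
        using ij by (simp add: sum.distrib sum_distrib_left[symmetric] \<mu>_def algebra_simps)
      finally show ?thesis using True by simp
    next
      case False
      have "(\<Sum>l<d. ((if i = l then \<alpha> else 0) + \<beta> * x i * x l) * (if l = j then 1 else 0))
          = (\<Sum>l<d. if l = j then (if i = j then \<alpha> else 0) + \<beta> * x i * x j else 0)"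
        by (intro sum.cong) auto
      then show ?thesis using False ij by simp
    qed
    have R: "(\<Sum>l<d. (if l = 0 then x i else if i = l then 1 else 0) *
         (if l = j then if l = 0 then \<mu> else \<alpha> else if l = 0 then \<beta> * x j else 0))
       = (\<Sum>l<d. (if l = 0 then x i * (if j = 0 then \<mu> else \<beta> * x j) else 0)
            + (if l = i then if i = 0 then 0 else if i = j then \<alpha> else 0 else 0))"
      by (intro sum.cong) auto
    also have "\<dots> = (if j = 0 then \<mu> * x i else (if i = j then \<alpha> else 0) + \<beta> * x i * x j)"
      using ij by (auto simp: sum.distrib)
    finally show "(A * P) $$ (i, j) = (P * U) $$ (i, j)"
      using ij L unfolding defs rank_one_perturb_def
      by (subst (1 2) mult_mat_entries) auto
  qed (simp_all add: defs rank_one_perturb_def)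
  have "A = A * (P * Q)" using carr PQ by simp
  also have "\<dots> = P * U * Q" using carr AP by (metis assoc_mult_mat)
  finally have "similar_mat A U"
    by (intro similar_matI[of _ _ P Q d]) (use carr PQ QP in auto)
  then have "char_poly A = char_poly U" by (rule char_poly_similar)
  also have "\<dots> = (\<Prod>a\<leftarrow>diag_mat U. [:- a, 1:])"
    by (rule char_poly_upper_triangular[of _ d]) (auto simp: U_def)
  also have "diag_mat U = \<mu> # replicate n \<alpha>"
    by (rule nth_equalityI) (auto simp: diag_mat_def U_def d nth_Cons' simp del: upt_Suc)
  finally show ?thesis by (simp add: A_def \<mu>_def d prod_list_replicate)
qed

lemma proots_linear_power:
  fixes a b :: real
  shows "proots ([:- a, 1:] * [:- b, 1:] ^ n) = add_mset a (replicate_mset n b)"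
proof -
  have "proots ([:- a, 1:] * [:- b, 1:] ^ n) = proots [:- a, 1:] + repeat_mset n (proots [:- b, 1:])"
    by (subst proots_mult) (auto simp: proots_power)
  also have "\<dots> = add_mset a (replicate_mset n b)"
    by (induction n) auto
  finally show ?thesis .
qed

lemma lambda_min_rank_one_perturb:
  assumes "0 < d" and "x 0 \<noteq> 0" and "\<beta> \<le> 0"
  shows "lambda_min (rank_one_perturb d \<alpha> \<beta> x) = \<alpha> + \<beta> * (\<Sum>i<d. (x i)\<^sup>2)"
proof -
  let ?A = "rank_one_perturb d \<alpha> \<beta> x" and ?\<mu> = "\<alpha> + \<beta> * (\<Sum>i<d. (x i)\<^sup>2)"
  have eq: "eigenvalue ?A k \<longleftrightarrow> k = ?\<mu> \<or> k = \<alpha> \<and> d > 1" for k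
    unfolding eigenvalue_root_char_poly[OF rank_one_perturb_carrier]
      char_poly_rank_one_perturb[where x = x, OF assms(1,2)] poly_mult poly_power mult_eq_0_iff
    by (auto simp: algebra_simps)
  have "?\<mu> \<le> \<alpha>" using \<open>\<beta> \<le> 0\<close> by (simp add: mult_nonpos_nonneg sum_nonneg)
  moreover have "spectrum ?A \<subseteq> {?\<mu>, \<alpha>}" "?\<mu> \<in> spectrum ?A"
    using eq by (auto simp: spectrum_def)
  ultimately show ?thesis
    unfolding lambda_min_def by (intro Min_eqI) (auto intro: finite_subset)
qed

lemma singular_values_rank_one_perturb:
  assumes "0 < d" and "x 0 \<noteq> 0"
  shows "singular_values (rank_one_perturb d \<alpha> \<beta> x)
    = add_mset \<bar>\<alpha> + \<beta> * (\<Sum>i<d. (x i)\<^sup>2)\<bar> (replicate_mset (d - 1) \<bar>\<alpha>\<bar>)"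
proof -
  let ?N = "\<Sum>i<d. (x i)\<^sup>2"
  have "\<alpha>\<^sup>2 + (2 * \<alpha> * \<beta> + \<beta>\<^sup>2 * ?N) * ?N = (\<alpha> + \<beta> * ?N)\<^sup>2"
    by (simp add: power2_eq_square algebra_simps)
  then show ?thesis
    unfolding singular_values_def transpose_rank_one_perturb rank_one_perturb_square
      char_poly_rank_one_perturb[where x = x, OF assms] proots_linear_power by simp
qed

text \<open>Each v in {u, t} satisfies v^p = v * v^(p-1) \<le> v * (u + t)^(p-1); adding the two
  bounds suffices. This stands in for the triangle inequality when the exceptional singular value is
  split off.\<close>

lemma add_powr_le:
  fixes u t p :: real
  assumes "0 \<le> u" "0 \<le> t" "1 \<le> p"
  shows "u powr p + t powr p \<le> (u + t) powr p"
proof (cases "u + t = 0")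
  case True
  then show ?thesis using assms by (simp add: add_nonneg_eq_0_iff)
next
  case False
  then have pos: "u + t > 0" using assms by simp
  have le: "v powr p \<le> v * (u + t) powr (p - 1)" if "0 \<le> v" "v \<le> u + t" for v
  proof (cases "v = 0")
    case False
    then have "v powr p = v * v powr (p - 1)"
      using that by (simp add: powr_mult_base)
    also have "\<dots> \<le> v * (u + t) powr (p - 1)"
      using that assms by (intro mult_left_mono powr_mono2) auto
    finally show ?thesis .
  qed simp
  have "u powr p + t powr p \<le> u * (u + t) powr (p - 1) + t * (u + t) powr (p - 1)"
    using assms by (intro add_mono le) auto
  also have "\<dots> = (u + t) powr p"
    using pos by (simp add: powr_mult_base flip: distrib_right)
  finally show ?thesis .
qed

text \<open>There are d - 1 singular values \<alpha> and one exceptional value. Rounding d - 1 up to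
  d turns the first term into the Schatten norm of \<alpha> I; for p = \<infinity> the exponent is 0
  and the factor is 1.\<close>

lemma schatten_norm_rank_one_perturb_le:
  assumes "0 < d" and "x 0 \<noteq> 0" and "1 \<le> p" and "0 \<le> \<alpha>"
  shows "schatten_norm p (rank_one_perturb d \<alpha> \<beta> x)
    \<le> real d powr recip_exponent p * \<alpha> + \<bar>\<alpha> + \<beta> * (\<Sum>i<d. (x i)\<^sup>2)\<bar>"
proof -
  define t where "t = \<bar>\<alpha> + \<beta> * (\<Sum>i<d. (x i)\<^sup>2)\<bar>"
  have t: "0 \<le> t" by (simp add: t_def)
  have sv: "singular_values (rank_one_perturb d \<alpha> \<beta> x) = add_mset t (replicate_mset (d - 1) \<alpha>)"
    using singular_values_rank_one_perturb[where x = x, OF assms(1,2)] \<open>0 \<le> \<alpha>\<close> by (simp add: t_def)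
  show ?thesis
  proof (cases "p = \<infinity>")
    case True
    then show ?thesis
      using t \<open>0 \<le> \<alpha>\<close> \<open>0 < d\<close>
      unfolding schatten_norm_def recip_exponent_def sv t_def[symmetric]
      by (auto simp: in_replicate_mset)
  next
    case False
    define P where "P = enn2real p"
    have P: "1 \<le> P"
      using enn2real_mono[OF \<open>1 \<le> p\<close>] False by (simp add: P_def top.not_eq_extremum)
    have "real (d - 1) * \<alpha> powr P + t powr P \<le> (real d powr (1 / P) * \<alpha>) powr P + t powr P"
      using P \<open>0 \<le> \<alpha>\<close> by (simp add: powr_mult powr_powr mult_right_mono)
    also have "\<dots> \<le> (real d powr (1 / P) * \<alpha> + t) powr P"
      using P t \<open>0 \<le> \<alpha>\<close> by (intro add_powr_le) auto
    finally have "(real (d - 1) * \<alpha> powr P + t powr P) powr (1 / P)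
        \<le> ((real d powr (1 / P) * \<alpha> + t) powr P) powr (1 / P)"
      using P by (intro powr_mono2) auto
    also have "\<dots> = real d powr (1 / P) * \<alpha> + t"
      using P t \<open>0 \<le> \<alpha>\<close> by (simp add: powr_powr)
    finally show ?thesis
      using False unfolding schatten_norm_def recip_exponent_def sv t_def[symmetric]
      by (simp add: P_def add.commute)
  qed
qed

section \<open>Second moments of linear and quadratic forms in random signs\<close>

lemma sum_Pow_Suc:
  fixes f :: "nat set \<Rightarrow> 'a :: comm_monoid_add"
  shows "(\<Sum>S\<in>Pow {..<Suc n}. f S) = (\<Sum>S\<in>Pow {..<n}. f S + f (insert n S))"
proof -
  have "inj_on (insert n) (Pow {..<n})"
    by (rule inj_onI) (auto dest!: subsetD simp: set_eq_iff)
  moreover have "Pow {..<n} \<inter> insert n ` Pow {..<n} = {}" by auto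
  ultimately show ?thesis
    by (simp add: lessThan_Suc Pow_insert sum.union_disjoint sum.reindex sum.distrib)
qed

text \<open>A sign vector is encoded by its set of indices with sign +1, so expectations over
  uniform signs are sums over \<open>Pow {..<n}\<close> divided by 2^n. Splitting by membership of
  the last index is conditioning on the last sign.\<close>

definition set_sign :: "nat set \<Rightarrow> nat \<Rightarrow> real" where
  "set_sign S i = (if i \<in> S then 1 else - 1)"

lemma set_sign_square [simp]: "set_sign S i * set_sign S i = 1" "(set_sign S i)\<^sup>2 = 1"
  by (simp_all add: set_sign_def)

lemma set_sign_nonzero [simp]: "set_sign S i \<noteq> 0"
  by (simp add: set_sign_def)

lemma set_sign_insert: "set_sign (insert n S) i = (if i = n then 1 else set_sign S i)"
  by (simp add: set_sign_def)

text \<open>The two values of the last sign give (L - a)^2 + (L + a)^2 = 2 L^2 + 2 a^2, so the cross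
  terms cancel.\<close>

lemma sum_Pow_linear_form_square:
  "(\<Sum>S\<in>Pow {..<n}. (\<Sum>i<n. a i * set_sign S i)\<^sup>2) = 2 ^ n * (\<Sum>i<n. (a i)\<^sup>2)"
proof (induction n)
  case (Suc n)
  have "(\<Sum>i<Suc n. a i * set_sign S i)\<^sup>2 + (\<Sum>i<Suc n. a i * set_sign (insert n S) i)\<^sup>2
      = 2 * (\<Sum>i<n. a i * set_sign S i)\<^sup>2 + 2 * (a n)\<^sup>2" if "S \<in> Pow {..<n}" for S
  proof -
    have "(\<Sum>i<n. a i * set_sign (insert n S) i) = (\<Sum>i<n. a i * set_sign S i)"
      by (intro sum.cong) (auto simp: set_sign_insert)
    moreover have "set_sign S n = - 1" using that by (auto simp: set_sign_def)
    ultimately show ?thesis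
      by (simp add: set_sign_insert power2_eq_square algebra_simps)
  qed
  then have "(\<Sum>S\<in>Pow {..<Suc n}. (\<Sum>i<Suc n. a i * set_sign S i)\<^sup>2)
      = (\<Sum>S\<in>Pow {..<n}. 2 * (\<Sum>i<n. a i * set_sign S i)\<^sup>2 + 2 * (a n)\<^sup>2)"
    unfolding sum_Pow_Suc by (intro sum.cong) auto
  also have "\<dots> = 2 * (2 ^ n * (\<Sum>i<n. (a i)\<^sup>2)) + 2 ^ n * (2 * (a n)\<^sup>2)"
    by (simp only: sum.distrib Suc.IH flip: sum_distrib_left) (simp add: card_Pow)
  finally show ?case by (simp add: algebra_simps)
qed simp

text \<open>The products x_i x_j with i < j are orthonormal. In the induction the last sign
  multiplies a linear form in the earlier signs; the cross terms cancel and the linear case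
  finishes.\<close>

lemma sum_Pow_quadratic_form_square:
  "(\<Sum>S\<in>Pow {..<n}. (\<Sum>j<n. \<Sum>i<j. a i j * set_sign S i * set_sign S j)\<^sup>2)
    = 2 ^ n * (\<Sum>j<n. \<Sum>i<j. (a i j)\<^sup>2)"
proof (induction n)
  case (Suc n)
  define q where "q S = (\<Sum>j<n. \<Sum>i<j. a i j * set_sign S i * set_sign S j)" for S
  define l where "l S = (\<Sum>i<n. a i n * set_sign S i)" for S
  have split: "(\<Sum>j<Suc n. \<Sum>i<j. a i j * set_sign S i * set_sign S j) = q S + l S * set_sign S n" for S
    by (simp add: q_def l_def sum_distrib_right)
  have "(q S + l S * set_sign S n)\<^sup>2 + (q (insert n S) + l (insert n S) * set_sign (insert n S) n)\<^sup>2
      = 2 * (q S)\<^sup>2 + 2 * (l S)\<^sup>2" if "S \<in> Pow {..<n}" for S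
  proof -
    have "l (insert n S) = l S" unfolding l_def
      by (intro sum.cong) (auto simp: set_sign_insert)
    moreover have "q (insert n S) = q S" unfolding q_def
      by (intro sum.cong refl) (auto simp: set_sign_insert)
    moreover have "set_sign S n = - 1" using that by (auto simp: set_sign_def)
    ultimately show ?thesis
      by (simp add: set_sign_insert power2_eq_square algebra_simps)
  qed
  then have "(\<Sum>S\<in>Pow {..<Suc n}. (\<Sum>j<Suc n. \<Sum>i<j. a i j * set_sign S i * set_sign S j)\<^sup>2)
      = (\<Sum>S\<in>Pow {..<n}. 2 * (q S)\<^sup>2 + 2 * (l S)\<^sup>2)"
    unfolding sum_Pow_Suc split by (intro sum.cong) auto
  also have "\<dots> = 2 * (2 ^ n * (\<Sum>j<n. \<Sum>i<j. (a i j)\<^sup>2)) + 2 * (2 ^ n * (\<Sum>i<n. (a i n)\<^sup>2))"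
    using Suc.IH sum_Pow_linear_form_square[of "\<lambda>i. a i n" n]
    by (simp add: q_def l_def sum.distrib flip: sum_distrib_left)
  finally show ?case by (simp add: algebra_simps)
qed simp

lemma sum_square_symmetric:
  fixes f :: "nat \<times> nat \<Rightarrow> 'a :: comm_ring_1"
  assumes "\<And>i j. f (i, j) = f (j, i)"
  shows "(\<Sum>k\<in>{..<n}\<times>{..<n}. f k) = (\<Sum>i<n. f (i, i)) + 2 * (\<Sum>j<n. \<Sum>i<j. f (i, j))"
proof -
  have "(\<Sum>i<n. \<Sum>j<n. f (i, j)) = (\<Sum>i<n. f (i, i)) + 2 * (\<Sum>j<n. \<Sum>i<j. f (i, j))"
  proof (induction n)
    case (Suc n)
    have "(\<Sum>i<n. f (n, i)) = (\<Sum>i<n. f (i, n))" by (intro sum.cong assms refl)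
    then show ?case using Suc.IH by (simp add: sum.distrib algebra_simps)
  qed simp
  then show ?thesis by (simp add: sum.cartesian_product)
qed

text \<open>The matrix x x^T without its diagonal. The diagonal is the identity for every sign
  vector and is merged into the multiple of I; what remains has mean zero.\<close>

definition sign_kernel :: "nat set \<Rightarrow> nat \<times> nat \<Rightarrow> real" where
  "sign_kernel S = (\<lambda>(i, j). if i = j then 0 else set_sign S i * set_sign S j)"

text \<open>Symmetry folds the sum into coefficients 2 F(i, j) over i < j. Their squares add up to 4
  times the sum over i < j, that is, twice the off-diagonal part of the squared norm of F; hence the
  factor 2.\<close>

lemma sum_Pow_sign_kernel_square_le:
  assumes sym: "\<And>i j. F (i, j) = F (j, i)"
  shows "(\<Sum>S\<in>Pow {..<d}. (\<Sum>k\<in>{..<d}\<times>{..<d}. F k * sign_kernel S k)\<^sup>2)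
    \<le> 2 ^ d * (2 * (\<Sum>k\<in>{..<d}\<times>{..<d}. (F k)\<^sup>2))"
proof -
  have "(\<Sum>k\<in>{..<d}\<times>{..<d}. F k * sign_kernel S k)
      = (\<Sum>j<d. \<Sum>i<j. 2 * F (i, j) * set_sign S i * set_sign S j)" for S
    by (subst sum_square_symmetric)
      (auto simp: sign_kernel_def sym mult_ac sum_distrib_left intro!: sum.cong)
  then have "(\<Sum>S\<in>Pow {..<d}. (\<Sum>k\<in>{..<d}\<times>{..<d}. F k * sign_kernel S k)\<^sup>2)
      = 2 ^ d * (\<Sum>j<d. \<Sum>i<j. (2 * F (i, j))\<^sup>2)"
    using sum_Pow_quadratic_form_square[of "\<lambda>i j. 2 * F (i, j)" d] by simp
  also have "(\<Sum>j<d. \<Sum>i<j. (2 * F (i, j))\<^sup>2) = 2 * (2 * (\<Sum>j<d. \<Sum>i<j. (F (i, j))\<^sup>2))"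
    by (simp add: power_mult_distrib sum_distrib_left)
  also have "2 * (\<Sum>j<d. \<Sum>i<j. (F (i, j))\<^sup>2) \<le> (\<Sum>k\<in>{..<d}\<times>{..<d}. (F k)\<^sup>2)"
    using sum_square_symmetric[of "\<lambda>k. (F k)\<^sup>2" d] sym by (simp add: sum_nonneg)
  finally show ?thesis by simp
qed

section \<open>Orthonormal basis for the span of the queries\<close>

text \<open>Gram-Schmidt for functions on \<open>K\<close>: a query whose residual vanishes adds no
  basis vector. Invariance under \<open>\<sigma>\<close> is carried along because
  \<open>\<sigma>\<close> will swap the two indices, and the projection onto the span must be a
  symmetric matrix.\<close>

lemma exists_orthonormal_expansion:
  fixes Qs :: "('k \<Rightarrow> real) list"
  assumes "finite K" and "\<forall>Q\<in>set Qs. Q \<circ> \<sigma> = Q"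
  shows "\<exists>(m::nat) F. m \<le> length Qs \<and> (\<forall>i<m. F i \<circ> \<sigma> = F i)
    \<and> (\<forall>i<m. \<forall>j<m. (\<Sum>k\<in>K. F i k * F j k) = (if i = j then 1 else 0))
    \<and> (\<forall>Q\<in>set Qs. \<forall>k\<in>K. Q k = (\<Sum>i<m. (\<Sum>k\<in>K. Q k * F i k) * F i k))"
  using assms(2)
proof (induction Qs)
  case Nil
  show ?case by (rule exI[of _ 0]) auto
next
  case (Cons Q Qs)
  have "\<forall>P\<in>set Qs. P \<circ> \<sigma> = P"
    by (intro ballI Cons.prems[rule_format] list.set_intros(2))
  from Cons.IH[OF this] obtain m F where m: "m \<le> length Qs" and sym: "\<forall>i<m. F i \<circ> \<sigma> = F i"
    and on: "\<forall>i<m. \<forall>j<m. (\<Sum>k\<in>K. F i k * F j k) = (if i = j then 1 else 0)"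
    and ex: "\<forall>P\<in>set Qs. \<forall>k\<in>K. P k = (\<Sum>i<m. (\<Sum>k\<in>K. P k * F i k) * F i k)"
    by (elim exE conjE) (rule that)
  note sym = sym[rule_format] and on = on[rule_format] and ex = ex[rule_format]
  define R where "R k = Q k - (\<Sum>i<m. (\<Sum>k\<in>K. Q k * F i k) * F i k)" for k
  have perp: "(\<Sum>k\<in>K. R k * F j k) = 0" if "j < m" for j
  proof -
    have "(\<Sum>k\<in>K. (\<Sum>i<m. (\<Sum>k\<in>K. Q k * F i k) * F i k) * F j k)
        = (\<Sum>i<m. (\<Sum>k\<in>K. Q k * F i k) * (\<Sum>k\<in>K. F i k * F j k))"
      unfolding sum_distrib_right sum_distrib_left by (subst sum.swap) (simp add: mult_ac)
    also have "\<dots> = (\<Sum>i<m. if i = j then \<Sum>k\<in>K. Q k * F j k else 0)"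
      using that by (intro sum.cong) (auto simp: on)
    also have "\<dots> = (\<Sum>k\<in>K. Q k * F j k)" using that by simp
    finally show ?thesis by (simp add: R_def left_diff_distrib sum_subtractf)
  qed
  show ?case
  proof (cases "\<forall>k\<in>K. R k = 0")
    case True
    then have new: "Q k = (\<Sum>i<m. (\<Sum>k\<in>K. Q k * F i k) * F i k)" if "k \<in> K" for k
      using that unfolding R_def by (subst eq_iff_diff_eq_0) blast
    show ?thesis
    proof (intro exI[of _ m] exI[of _ F] conjI allI impI ballI)
      fix P k assume P: "P \<in> set (Q # Qs)" and k: "k \<in> K"
      show "P k = (\<Sum>i<m. (\<Sum>k\<in>K. P k * F i k) * F i k)"
      proof (cases "P \<in> set Qs")
        case True
        then show ?thesis using k by (rule ex)
      next
        case False
        with P have "P = Q" by simp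
        then show ?thesis using new[OF k] by (simp only:)
      qed
    qed (use m in simp, fact sym, fact on)
  next
    case False
    define r where "r = sqrt (\<Sum>k\<in>K. (R k)\<^sup>2)"
    from False obtain k0 where "k0 \<in> K" "R k0 \<noteq> 0" by auto
    then have pos: "(\<Sum>k\<in>K. (R k)\<^sup>2) > 0"
      using \<open>finite K\<close> by (intro sum_pos2[of _ k0]) auto
    then have r: "r > 0" "r * r = (\<Sum>k\<in>K. (R k)\<^sup>2)" by (simp_all add: r_def)
    define G where "G = F(m := \<lambda>k. R k / r)"
    have "R \<circ> \<sigma> = R"
    proof
      fix k
      have "Q (\<sigma> k) = Q k" using Cons.prems by (metis list.set_intros(1) o_apply)
      moreover have "F i (\<sigma> k) = F i k" if "i < m" for i using sym[OF that] by (metis o_apply)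
      ultimately show "(R \<circ> \<sigma>) k = R k" by (simp add: R_def)
    qed
    then have Gsym: "G i \<circ> \<sigma> = G i" if "i < Suc m" for i
      using that sym[of i] by (cases "i = m") (auto simp: G_def fun_eq_iff)
    have RR: "(\<Sum>k\<in>K. R k / r * (R k / r)) = 1"
      using r pos by (simp add: power2_eq_square flip: sum_divide_distrib)
    have Rp: "(\<Sum>k\<in>K. R k / r * F j k) = 0" "(\<Sum>k\<in>K. F j k * (R k / r)) = 0" if "j < m" for j
      using perp[OF that] by (simp_all add: mult.commute flip: sum_divide_distrib)
    have Gon: "(\<Sum>k\<in>K. G i k * G j k) = (if i = j then 1 else 0)" if "i < Suc m" "j < Suc m" for i j
      using that on Rp RR by (auto simp: G_def less_Suc_eq)
    have Gexp: "(\<Sum>i<Suc m. (\<Sum>k\<in>K. P k * G i k) * G i k)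
        = (\<Sum>i<m. (\<Sum>k\<in>K. P k * F i k) * F i k) + (\<Sum>k\<in>K. P k * R k) / r * (R k / r)" for P k
      by (simp add: G_def sum_divide_distrib)
    have R_perp: "(\<Sum>k\<in>K. (\<Sum>i<m. c i * F i k) * R k) = 0" for c
    proof -
      have "(\<Sum>k\<in>K. (\<Sum>i<m. c i * F i k) * R k) = (\<Sum>i<m. c i * (\<Sum>k\<in>K. R k * F i k))"
        unfolding sum_distrib_right sum_distrib_left by (subst sum.swap) (simp add: mult_ac)
      then show ?thesis by (simp add: perp)
    qed
    have Gex: "P k = (\<Sum>i<Suc m. (\<Sum>k\<in>K. P k * G i k) * G i k)" if "P \<in> set (Q # Qs)" "k \<in> K" for P k
    proof (cases "P \<in> set Qs")
      case True
      have "(\<Sum>k\<in>K. P k * R k) = (\<Sum>k\<in>K. (\<Sum>i<m. (\<Sum>k\<in>K. P k * F i k) * F i k) * R k)"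
        by (intro sum.cong refl arg_cong2[of _ _ _ _ "(*)"] ex[OF True])
      then have "(\<Sum>k\<in>K. P k * R k) = 0" by (simp add: R_perp)
      then have "(\<Sum>i<Suc m. (\<Sum>k\<in>K. P k * G i k) * G i k)
          = (\<Sum>i<m. (\<Sum>k\<in>K. P k * F i k) * F i k)"
        unfolding Gexp by simp
      with ex[OF True \<open>k \<in> K\<close>] show ?thesis by (rule trans[OF _ HOL.sym])
    next
      case False
      then have "P = Q" using that by simp
      \<comment> \<open>The residual is orthogonal to the projected part of \<open>Q\<close>, so its
        inner product with \<open>Q\<close> is its own squared norm, and the new basis vector
        contributes exactly \<open>R\<close> to the expansion.\<close>
      have "(\<Sum>k\<in>K. Q k * R k)
          = (\<Sum>k\<in>K. (R k)\<^sup>2 + (\<Sum>i<m. (\<Sum>k\<in>K. Q k * F i k) * F i k) * R k)"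
        by (intro sum.cong) (auto simp: R_def power2_eq_square algebra_simps)
      also have "\<dots> = r * r" by (simp add: sum.distrib R_perp r)
      finally have "(\<Sum>k\<in>K. Q k * R k) / r * (R k / r) = R k" using r pos by simp
      moreover have "Q k = (\<Sum>i<m. (\<Sum>k\<in>K. Q k * F i k) * F i k) + R k" by (simp add: R_def)
      ultimately show ?thesis unfolding Gexp \<open>P = Q\<close> by (simp only:)
    qed
    show ?thesis
    proof (intro exI[of _ "Suc m"] exI[of _ G] conjI allI impI ballI)
      show "Suc m \<le> length (Q # Qs)" using m by simp
    qed (fact Gsym, fact Gon, fact Gex)
  qed
qed

section \<open>Fixing the random coins\<close>

text \<open>The expected number of events that occur is the sum of their probabilities, and some
  point reaches at least this average. It yields one outcome of the coins that rejects many
  inputs.\<close>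

lemma (in prob_space) exists_point_in_many_events:
  assumes "finite I" and "\<And>i. i \<in> I \<Longrightarrow> E i \<in> events" and "\<And>i. i \<in> I \<Longrightarrow> c \<le> prob (E i)"
  shows "\<exists>\<omega>\<in>space M. c * real (card I) \<le> real (card {i \<in> I. \<omega> \<in> E i})"
proof (rule ccontr)
  assume "\<not> ?thesis"
  then have lt: "real (card {i \<in> I. \<omega> \<in> E i}) < c * real (card I)" if "\<omega> \<in> space M" for \<omega>
    using that by (simp add: not_le)
  have count: "(\<Sum>i\<in>I. indicator (E i) \<omega>) = real (card {i \<in> I. \<omega> \<in> E i})" for \<omega>
    using \<open>finite I\<close> by (simp add: indicator_def sum.If_cases Int_def)
  have int: "integrable M (\<lambda>\<omega>. \<Sum>i\<in>I. indicator (E i) \<omega> :: real)"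
    using assms(2) by (intro Bochner_Integration.integrable_sum integrable_real_indicator)
      (auto simp: emeasure_eq_measure)
  have "expectation (\<lambda>\<omega>. \<Sum>i\<in>I. indicator (E i) \<omega>) < c * real (card I)"
    using lt by (intro expectation_less int) (auto simp: count)
  moreover have "expectation (\<lambda>\<omega>. \<Sum>i\<in>I. indicator (E i) \<omega>) = (\<Sum>i\<in>I. prob (E i))"
    using assms(2) by (subst Bochner_Integration.integral_sum) (auto simp: emeasure_eq_measure)
  moreover have "c * real (card I) \<le> (\<Sum>i\<in>I. prob (E i))"
    using sum_bounded_below[of I c "\<lambda>i. prob (E i)"] assms(3) by (simp add: mult.commute)
  ultimately show False by simp
qed

section \<open>A PSD matrix with the same answers\<close>

unbundle no vec_syntax

lemma bilinear_form_mat: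
  assumes "v \<in> carrier_vec d" "w \<in> carrier_vec d"
  shows "scalar_prod v (mat d d f *\<^sub>v w)
    = (\<Sum>k\<in>{..<d}\<times>{..<d}. v $ fst k * w $ snd k * (f k :: real))"
proof -
  have "scalar_prod v (mat d d f *\<^sub>v w) = (\<Sum>i<d. \<Sum>j<d. v $ i * w $ j * f (i, j))"
    using assms by (simp add: scalar_prod_def atLeast0LessThan sum_distrib_left mult_ac)
  then show ?thesis by (simp add: sum.cartesian_product split_def)
qed

text \<open>By Cauchy-Schwarz the quadratic form of \<open>Z\<close> at v is at most the Frobenius
  norm of \<open>Z\<close> times |v|^2, hence at most c |v|^2 in absolute value.\<close>

lemma psd_mat_scaled_one_plus_small:
  assumes "0 \<le> c" and sym: "\<And>i j. Z (i, j) = Z (j, i)"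
    and small: "(\<Sum>k\<in>{..<d}\<times>{..<d}. (Z k)\<^sup>2) \<le> c\<^sup>2"
  shows "psd_mat d (mat d d (\<lambda>(i, j). (if i = j then c else 0) + Z (i, j)))" (is "psd_mat d ?B")
proof -
  let ?K = "{..<d} \<times> {..<d}"
  have "0 \<le> scalar_prod v (?B *\<^sub>v v)" if v: "v \<in> carrier_vec d" for v
  proof -
    define n2 where "n2 = (\<Sum>i<d. (v $ i)\<^sup>2)"
    define z where "z = (\<Sum>k\<in>?K. v $ fst k * v $ snd k * Z k)"
    have "(\<Sum>k\<in>?K. v $ fst k * v $ snd k * (if fst k = snd k then c else 0))
        = (\<Sum>i<d. \<Sum>j<d. if i = j then c * (v $ i)\<^sup>2 else 0)"
      unfolding sum.cartesian_product
      by (intro sum.cong) (auto simp: power2_eq_square)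
    also have "\<dots> = c * n2" by (simp add: n2_def sum_distrib_left)
    finally have form: "scalar_prod v (?B *\<^sub>v v) = c * n2 + z"
      unfolding bilinear_form_mat[OF v v] by (simp add: z_def split_def distrib_left sum.distrib)
    have "(\<Sum>k\<in>?K. (v $ fst k * v $ snd k)\<^sup>2) = n2\<^sup>2"
      by (simp add: n2_def power2_eq_square[of "sum _ _"] sum_product sum.cartesian_product
          split_def power_mult_distrib)
    then have "z\<^sup>2 \<le> n2\<^sup>2 * (\<Sum>k\<in>?K. (Z k)\<^sup>2)"
      using Cauchy_Schwarz_ineq_sum[of "\<lambda>k. v $ fst k * v $ snd k" Z ?K] by (simp add: z_def)
    also have "\<dots> \<le> n2\<^sup>2 * c\<^sup>2" using small by (intro mult_left_mono) auto
    finally have "\<bar>z\<bar>\<^sup>2 \<le> (c * n2)\<^sup>2" by (simp add: power_mult_distrib mult.commute)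
    moreover have "0 \<le> c * n2" using \<open>0 \<le> c\<close> by (simp add: n2_def sum_nonneg)
    ultimately have "\<bar>z\<bar> \<le> c * n2" by (rule power2_le_imp_le)
    then show ?thesis unfolding form by linarith
  qed
  moreover have "sym_mat d ?B"
    unfolding sym_mat_def by (auto intro!: eq_matI simp: sym)
  ultimately show ?thesis by (simp add: psd_mat_def)
qed

text \<open>The symmetric part of v w^T. On a symmetric matrix the query (v, w) is the Frobenius
  inner product with this kernel, so the span of the queries can be taken inside the symmetric
  matrices.\<close>

definition sym_kernel :: "real vec \<Rightarrow> real vec \<Rightarrow> nat \<times> nat \<Rightarrow> real" where
  "sym_kernel v w = (\<lambda>(i, j). (v $ i * w $ j + v $ j * w $ i) / 2)"

lemma sum_sym_kernel:
  assumes "\<And>i j. Z (i, j) = Z (j, i)"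
  shows "(\<Sum>k\<in>{..<d}\<times>{..<d}. v $ fst k * w $ snd k * Z k)
    = (\<Sum>k\<in>{..<d}\<times>{..<d}. sym_kernel v w k * Z k)"
proof -
  have swap: "(\<Sum>k\<in>{..<d}\<times>{..<d}. v $ fst k * w $ snd k * Z k)
      = (\<Sum>k\<in>{..<d}\<times>{..<d}. v $ snd k * w $ fst k * Z k)"
    by (rule sum.reindex_bij_witness[of _ prod.swap prod.swap]) (auto simp: assms)
  have "(\<Sum>k\<in>{..<d}\<times>{..<d}. sym_kernel v w k * Z k)
      = ((\<Sum>k\<in>{..<d}\<times>{..<d}. v $ fst k * w $ snd k * Z k)
        + (\<Sum>k\<in>{..<d}\<times>{..<d}. v $ snd k * w $ fst k * Z k)) / 2"
    unfolding sum.distrib[symmetric] sum_divide_distrib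
    by (intro sum.cong) (auto simp: sym_kernel_def field_simps)
  then show ?thesis using swap by simp
qed

lemma rank_one_perturb_sign:
  "rank_one_perturb d 1 (- b) (set_sign S)
    = mat d d (\<lambda>(i, j). (if i = j then 1 - b else 0) + - b * sign_kernel S (i, j))"
  unfolding rank_one_perturb_def by (rule eq_matI) (auto simp: sign_kernel_def)

text \<open>Markov's inequality in counting form, for fixed coins: a rejected sign vector must have
  a projection of squared norm above ((1 - b) / b)^2, while the mean of this squared norm is at most
  twice the number of queries.\<close>

lemma one_sided_rejection_bound:
  assumes b: "0 < b" "b < 1"
    and qs: "set (queries T) \<subseteq> carrier_vec d \<times> carrier_vec d"
    and acc: "\<And>A. psd_mat d A \<Longrightarrow> run_tester T A"
  shows "real (card {S \<in> Pow {..<d}. \<not> run_tester T (rank_one_perturb d 1 (- b) (set_sign S))})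
      * (1 - b)\<^sup>2 \<le> 2 ^ d * (2 * b\<^sup>2 * real (length (queries T)))"
proof -
  let ?K = "{..<d} \<times> {..<d}"
  let ?Qs = "map (\<lambda>(v, w). sym_kernel v w) (queries T)"
  have "\<forall>Q\<in>set ?Qs. Q \<circ> prod.swap = Q"
    by (auto simp: fun_eq_iff sym_kernel_def)
  from exists_orthonormal_expansion[of ?K ?Qs prod.swap,
      OF finite_cartesian_product[OF finite_lessThan finite_lessThan] this]
  obtain m F where m: "m \<le> length ?Qs" and Fswap: "\<forall>i<m. F i \<circ> prod.swap = F i"
    and on: "\<forall>i<m. \<forall>j<m. (\<Sum>k\<in>?K. F i k * F j k) = (if i = j then 1 else 0)"
    and ex: "\<forall>Q\<in>set ?Qs. \<forall>k\<in>?K. Q k = (\<Sum>i<m. (\<Sum>k\<in>?K. Q k * F i k) * F i k)"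
    by (elim exE conjE) (rule that)
  note Fswap = Fswap[rule_format] and on = on[rule_format] and ex = ex[rule_format]
  have Fsym: "F l (i, j) = F l (j, i)" if "l < m" for l i j
    using fun_cong[OF Fswap[OF that], of "(i, j)"] by simp
  define c where "c S l = (\<Sum>k\<in>?K. F l k * sign_kernel S k)" for S l
  \<comment> \<open>The orthogonal projection of the sign kernel onto the span of the queries. Its
    difference from the sign kernel is orthogonal to every query and therefore invisible to the
    tester.\<close>
  define Z where "Z S k = (\<Sum>l<m. c S l * F l k)" for S k
  have Zsym: "Z S (i, j) = Z S (j, i)" for S i j
    unfolding Z_def using Fsym by (intro sum.cong) auto
  have Ysym: "sign_kernel S (i, j) = sign_kernel S (j, i)" for S i j
    by (simp add: sign_kernel_def)
  have Z_norm: "(\<Sum>k\<in>?K. (Z S k)\<^sup>2) = (\<Sum>l<m. (c S l)\<^sup>2)" for S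
  proof -
    have "(\<Sum>k\<in>?K. (Z S k)\<^sup>2) = (\<Sum>k\<in>?K. \<Sum>l<m. \<Sum>l'<m. c S l * c S l' * (F l k * F l' k))"
      by (simp add: Z_def power2_eq_square sum_product mult_ac)
    also have "\<dots> = (\<Sum>l<m. \<Sum>k\<in>?K. \<Sum>l'<m. c S l * c S l' * (F l k * F l' k))"
      by (rule sum.swap)
    also have "\<dots> = (\<Sum>l<m. \<Sum>l'<m. \<Sum>k\<in>?K. c S l * c S l' * (F l k * F l' k))"
      by (intro sum.cong refl sum.swap)
    also have "\<dots> = (\<Sum>l<m. \<Sum>l'<m. if l = l' then (c S l)\<^sup>2 else 0)"
      by (intro sum.cong refl) (simp add: on power2_eq_square flip: sum_distrib_left)
    finally show ?thesis by simp
  qed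
  have answers: "(\<Sum>k\<in>?K. Q k * Z S k) = (\<Sum>k\<in>?K. Q k * sign_kernel S k)" if "Q \<in> set ?Qs" for Q S
  proof -
    have "(\<Sum>k\<in>?K. Q k * sign_kernel S k)
        = (\<Sum>k\<in>?K. \<Sum>l<m. (\<Sum>k\<in>?K. Q k * F l k) * (F l k * sign_kernel S k))"
    proof (intro sum.cong refl)
      fix k assume "k \<in> ?K"
      from arg_cong[OF ex[OF that this], of "\<lambda>r. r * sign_kernel S k"]
      show "Q k * sign_kernel S k = (\<Sum>l<m. (\<Sum>k\<in>?K. Q k * F l k) * (F l k * sign_kernel S k))"
        by (simp only: sum_distrib_right mult.assoc)
    qed
    also have "\<dots> = (\<Sum>l<m. (\<Sum>k\<in>?K. Q k * F l k) * c S l)"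
      by (subst sum.swap) (simp add: c_def flip: sum_distrib_left)
    also have "\<dots> = (\<Sum>l<m. \<Sum>k\<in>?K. Q k * (c S l * F l k))"
      unfolding sum_distrib_right by (simp add: mult_ac)
    also have "\<dots> = (\<Sum>k\<in>?K. Q k * Z S k)"
      unfolding Z_def sum_distrib_left by (rule sum.swap)
    finally show ?thesis ..
  qed
  let ?A = "\<lambda>S. rank_one_perturb d 1 (- b) (set_sign S)"
  have accept: "run_tester T (?A S)" if small: "b\<^sup>2 * (\<Sum>l<m. (c S l)\<^sup>2) \<le> (1 - b)\<^sup>2" for S
  proof -
    define B where "B = mat d d (\<lambda>(i, j). (if i = j then 1 - b else 0) + - b * Z S (i, j))"
    have "psd_mat d B"
      unfolding B_def using b small
      by (intro psd_mat_scaled_one_plus_small)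
        (auto simp: Zsym power_mult_distrib Z_norm simp flip: sum_distrib_left)
    then have "run_tester T B" by (rule acc)
    moreover have "scalar_prod v (B *\<^sub>v w) = scalar_prod v (?A S *\<^sub>v w)"
      if "(v, w) \<in> set (queries T)" for v w
    proof -
      have vw: "v \<in> carrier_vec d" "w \<in> carrier_vec d" using that qs by auto
      have eq: "scalar_prod v (mat d d (\<lambda>(i, j). (if i = j then 1 - b else 0) + - b * X (i, j)) *\<^sub>v w)
          = (\<Sum>k\<in>?K. v $ fst k * w $ snd k * (if fst k = snd k then 1 - b else 0))
            - b * (\<Sum>k\<in>?K. sym_kernel v w k * X k)" if "\<And>i j. X (i, j) = X (j, i)" for X
        unfolding bilinear_form_mat[OF vw] sum_sym_kernel[of X, OF that, symmetric]
        by (simp add: split_def algebra_simps sum_subtractf sum_distrib_left)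
      have "sym_kernel v w \<in> set ?Qs" using that by force
      then show ?thesis
        unfolding B_def rank_one_perturb_sign eq[of "Z S", OF Zsym] eq[of "sign_kernel S", OF Ysym]
        by (simp only: answers)
    qed
    ultimately show ?thesis
      unfolding run_tester_def
      by (auto elim!: back_subst[of "decide T"] intro!: map_cong)
  qed
  define R where "R = {S \<in> Pow {..<d}. \<not> run_tester T (?A S)}"
  \<comment> \<open>Markov's inequality: every rejected sign vector contributes at least (1 - b)^2,
    and the other sign vectors contribute nonnegative terms.\<close>
  have "real (card R) * (1 - b)\<^sup>2 = (\<Sum>S\<in>R. (1 - b)\<^sup>2)" by simp
  also have "\<dots> \<le> (\<Sum>S\<in>R. b\<^sup>2 * (\<Sum>l<m. (c S l)\<^sup>2))"
    using accept by (intro sum_mono) (force simp: R_def)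
  also have "\<dots> \<le> (\<Sum>S\<in>Pow {..<d}. b\<^sup>2 * (\<Sum>l<m. (c S l)\<^sup>2))"
    by (intro sum_mono2) (auto simp: R_def intro!: mult_nonneg_nonneg sum_nonneg)
  also have "\<dots> = b\<^sup>2 * (\<Sum>l<m. \<Sum>S\<in>Pow {..<d}. (c S l)\<^sup>2)"
    by (subst sum.swap) (simp add: sum_distrib_left)
  also have "\<dots> \<le> b\<^sup>2 * (\<Sum>l<m. 2 ^ d * (2 * 1))"
  proof (intro mult_left_mono sum_mono)
    fix l assume "l \<in> {..<m}"
    then have "l < m" by simp
    then show "(\<Sum>S\<in>Pow {..<d}. (c S l)\<^sup>2) \<le> 2 ^ d * (2 * 1)"
      using sum_Pow_sign_kernel_square_le[of "F l" d, OF Fsym] on[of l l]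
      by (simp add: c_def power2_eq_square)
  qed simp
  also have "\<dots> \<le> 2 ^ d * (2 * b\<^sup>2 * real (length (queries T)))"
    using m by (simp add: mult_right_mono)
  finally show ?thesis unfolding R_def .
qed

section \<open>Far inputs and the query bound\<close>

text \<open>Here -lambda_min = b d - \<alpha>, and the norm is at most \<alpha> d^(1/p) + (b d -
  \<alpha>); \<open>gap\<close> is the resulting farness condition solved for b d - \<alpha>. The
  case \<alpha> = 1 is the random input, \<alpha> = 0 a pure rank-one input.\<close>

lemma rank_one_perturb_sign_far:
  fixes S :: "nat set"
  assumes "1 \<le> d" "1 \<le> p" "0 < \<epsilon>" "\<epsilon> < 1" "0 \<le> \<alpha>" "0 \<le> b" "\<alpha> < b * real d"
    and gap: "\<epsilon> * (real d powr recip_exponent p * \<alpha>) \<le> (1 - \<epsilon>) * (b * real d - \<alpha>)"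
  defines "A \<equiv> rank_one_perturb d \<alpha> (- b) (set_sign S)"
  shows "sym_mat d A \<and> A \<noteq> 0\<^sub>m d d \<and> lambda_min A \<le> - \<epsilon> * schatten_norm p A"
proof (intro conjI)
  \<comment> \<open>The zero matrix belongs to the same family and has \<open>lambda_min\<close> 0,
    whereas that of \<open>A\<close> is negative.\<close>
  have "lambda_min (rank_one_perturb d 0 0 (set_sign S)) = 0"
    using lambda_min_rank_one_perturb[of d "set_sign S" 0 0] \<open>1 \<le> d\<close> by simp
  moreover have "rank_one_perturb d 0 0 (set_sign S) = 0\<^sub>m d d"
    by (rule eq_matI) (auto simp: rank_one_perturb_def)
  moreover have lam: "lambda_min A = \<alpha> - b * real d"
    unfolding A_def using lambda_min_rank_one_perturb[of d "set_sign S" "- b" \<alpha>] \<open>1 \<le> d\<close> \<open>0 \<le> b\<close> by simp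
  ultimately show "A \<noteq> 0\<^sub>m d d" using \<open>\<alpha> < b * real d\<close> by auto
  have "schatten_norm p A \<le> real d powr recip_exponent p * \<alpha> + (b * real d - \<alpha>)"
    unfolding A_def using schatten_norm_rank_one_perturb_le[of d "set_sign S" p \<alpha> "- b"] assms by simp
  then have "\<epsilon> * schatten_norm p A \<le> \<epsilon> * (real d powr recip_exponent p * \<alpha> + (b * real d - \<alpha>))"
    using \<open>0 < \<epsilon>\<close> by simp
  also have "\<dots> \<le> b * real d - \<alpha>" using gap by (simp add: algebra_simps)
  finally show "lambda_min A \<le> - \<epsilon> * schatten_norm p A" using lam by simp
qed (simp add: A_def sym_mat_rank_one_perturb)

lemma psd_mat_one: "psd_mat d (1\<^sub>m d)"
  by (auto simp: psd_mat_def sym_mat_def scalar_prod_def intro!: sum_nonneg)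

text \<open>Without queries the decision depends on the coins alone, so accepting I means accepting
  everything. This covers the range where the claimed bound is at most a constant.\<close>

lemma tester_makes_query:
  assumes "1 \<le> d" "1 \<le> p" "0 < \<epsilon>" "\<epsilon> < 1"
    and tester: "nonadaptive_tester d \<epsilon> p M" and os: "one_sided d M" and q: "makes_at_most_queries M q"
  shows "1 \<le> q"
proof (rule ccontr)
  assume "\<not> 1 \<le> q"
  then have "q = 0" by simp
  then have noq: "queries T = []" if "T \<in> space M" for T
    using q that by (auto simp: makes_at_most_queries_def)
  \<comment> \<open>of rank one, hence far from PSD for every \<open>p\<close>, unlike \<open>- I\<close>\<close>
  let ?A = "rank_one_perturb d 0 (- 1) (set_sign {})"
  have "sym_mat d ?A \<and> ?A \<noteq> 0\<^sub>m d d \<and> lambda_min ?A \<le> - \<epsilon> * schatten_norm p ?A"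
    using assms by (intro rank_one_perturb_sign_far) auto
  then have "measure M {T \<in> space M. \<not> run_tester T ?A} \<ge> 2 / 3"
    using tester by (auto simp: nonadaptive_tester_def)
  moreover have "run_tester T ?A" if "T \<in> space M" for T
  proof -
    have "run_tester T (1\<^sub>m d)" using os that psd_mat_one[of d] by (auto simp: one_sided_def)
    then show ?thesis using noq[OF that] by (simp add: run_tester_def)
  qed
  then have "{T \<in> space M. \<not> run_tester T ?A} = {}" by auto
  ultimately show False by simp
qed

text \<open>Some outcome of the coins rejects two thirds of all sign vectors, and the counting bound
  applies to it. The constant 3 is 2 divided by 2/3.\<close>

lemma one_sided_tester_query_bound:
  assumes "1 \<le> d" "1 \<le> p" "0 < \<epsilon>" "\<epsilon> < 1"
    and tester: "nonadaptive_tester d \<epsilon> p M" and os: "one_sided d M" and q: "makes_at_most_queries M q"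
    and b: "0 < b" "b < 1" "1 < b * real d"
    and gap: "\<epsilon> * real d powr recip_exponent p \<le> (1 - \<epsilon>) * (b * real d - 1)"
  shows "(1 - b)\<^sup>2 \<le> 3 * b\<^sup>2 * real q"
proof -
  interpret prob_space M using tester by (simp add: nonadaptive_tester_def)
  let ?A = "\<lambda>S. rank_one_perturb d 1 (- b) (set_sign S)"
  define E where "E S = {T \<in> space M. \<not> run_tester T (?A S)}" for S
  have "sym_mat d (?A S) \<and> ?A S \<noteq> 0\<^sub>m d d \<and> lambda_min (?A S) \<le> - \<epsilon> * schatten_norm p (?A S)" for S
    using assms by (intro rank_one_perturb_sign_far) auto
  then have prob: "2 / 3 \<le> prob (E S)" for S
    using tester by (auto simp: nonadaptive_tester_def E_def)
  \<comment> \<open>A set outside the sigma-algebra has measure 0, so a measure of at least 2/3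
    implies measurability.\<close>
  then have "E S \<in> events" for S
    using measure_notin_sets[of "E S" M] by (metis not_numeral_le_zero divide_le_0_iff)
  with prob obtain T where T: "T \<in> space M"
    and "2 / 3 * real (card (Pow {..<d})) \<le> real (card {S \<in> Pow {..<d}. T \<in> E S})"
    using exists_point_in_many_events[of "Pow {..<d}" E "2 / 3"] by auto
  then have "2 / 3 * 2 ^ d * (1 - b)\<^sup>2
      \<le> real (card {S \<in> Pow {..<d}. \<not> run_tester T (?A S)}) * (1 - b)\<^sup>2"
    by (intro mult_right_mono) (simp_all add: E_def card_Pow)
  also have "\<dots> \<le> 2 ^ d * (2 * b\<^sup>2 * real (length (queries T)))"
    using T tester os b
    by (intro one_sided_rejection_bound) (auto simp: nonadaptive_tester_def one_sided_def)
  also have "\<dots> \<le> 2 ^ d * (2 * b\<^sup>2 * real q)"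
    using T q by (intro mult_left_mono) (auto simp: makes_at_most_queries_def)
  finally have "2 ^ d * (2 / 3 * (1 - b)\<^sup>2) \<le> 2 ^ d * (2 * b\<^sup>2 * real q)" by (simp add: mult_ac)
  then have "2 / 3 * (1 - b)\<^sup>2 \<le> 2 * b\<^sup>2 * real q"
    by (subst (asm) mult_le_cancel_left_pos) auto
  then show ?thesis by (simp add: mult_ac)
qed

theorem theorem13:
  fixes \<epsilon>\<^sub>0 :: real
  assumes "0 < \<epsilon>\<^sub>0" and "\<epsilon>\<^sub>0 < 1"
  shows "\<exists>c::real. c > 0 \<and>
    (\<forall>(p::ennreal) (d::nat) (\<epsilon>::real) (M::det_tester measure) (q::nat).
       1 \<le> p \<and> 1 \<le> d \<and> 0 < \<epsilon> \<and> \<epsilon> \<le> \<epsilon>\<^sub>0 \<and>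
       nonadaptive_tester d \<epsilon> p M \<and> one_sided d M \<and> makes_at_most_queries M q \<longrightarrow>
       real q \<ge> c * min (1 / \<epsilon>\<^sup>2 * real d powr (2 - 2 * recip_exponent p)) ((real d)\<^sup>2))"
proof (intro exI[of _ "(1 - \<epsilon>\<^sub>0)\<^sup>2 / 48"] conjI allI impI; (elim conjE)?)
  \<comment> \<open>48 = 3 * 4 * 4: the 3 of the query bound, a 4 from (1 - b)^2 \<ge> 1/4, and a 4
    from the comparison of \<open>D\<close> with d^2 / s^2.\<close>
  show "(1 - \<epsilon>\<^sub>0)\<^sup>2 / 48 > 0" using assms by simp
next
  fix p :: ennreal and d :: nat and \<epsilon> :: real and M :: "det_tester measure" and q :: nat
  assume p: "1 \<le> p" and d: "1 \<le> d" and \<epsilon>: "0 < \<epsilon>" "\<epsilon> \<le> \<epsilon>\<^sub>0"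
    and tester: "nonadaptive_tester d \<epsilon> p M" "one_sided d M" "makes_at_most_queries M q"
  have "\<epsilon> < 1" using \<epsilon> assms by simp
  define \<delta> where "\<delta> = 1 - \<epsilon>\<^sub>0"
  have \<delta>: "0 < \<delta>" "\<delta> < 1" "\<delta> \<le> 1 - \<epsilon>" using assms \<epsilon> by (auto simp: \<delta>_def)
  define r where "r = \<epsilon> * real d powr recip_exponent p"
  have r: "0 < r" using \<epsilon> d by (simp add: r_def)
  \<comment> \<open>The intended value of b d. It satisfies \<delta> (s - 1) = r, and \<delta> \<le>
    1 - \<epsilon> makes this imply the farness condition, with \<delta> independent of
    \<epsilon>.\<close>
  define s where "s = 1 + r / \<delta>"
  define D where "D = min (1 / \<epsilon>\<^sup>2 * real d powr (2 - 2 * recip_exponent p)) ((real d)\<^sup>2)"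
  have "(real d powr recip_exponent p)\<^sup>2 = real d powr (2 * recip_exponent p)"
    by (simp add: power2_eq_square flip: powr_add)
  then have "real d powr (2 - 2 * recip_exponent p) = (real d)\<^sup>2 / (real d powr recip_exponent p)\<^sup>2"
    using d by (simp add: powr_diff)
  then have D: "D = min ((real d)\<^sup>2 / r\<^sup>2) ((real d)\<^sup>2)"
    by (simp add: D_def r_def power_mult_distrib)
  \<comment> \<open>Both sides are compared through max(1, r): s \<delta> = \<delta> + r is at most
    twice it, and \<open>D\<close> is at most d^2 divided by its square.\<close>
  have "s\<^sup>2 * D * \<delta>\<^sup>2 \<le> 4 * (real d)\<^sup>2"
  proof -
    have "s * \<delta> = \<delta> + r" using \<delta> by (simp add: s_def field_simps)
    then have "s * \<delta> \<le> 2 * max 1 r" using \<delta> by linarith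
    then have "(s * \<delta>)\<^sup>2 \<le> (2 * max 1 r)\<^sup>2"
      using \<delta> r by (intro power_mono) (auto simp: s_def)
    moreover have "D * (max 1 r)\<^sup>2 \<le> (real d)\<^sup>2"
    proof (cases "r \<le> 1")
      case False
      then have "D * r\<^sup>2 \<le> (real d)\<^sup>2 / r\<^sup>2 * r\<^sup>2" unfolding D by (intro mult_right_mono) auto
      then show ?thesis using False by simp
    qed (simp add: D)
    moreover have "0 \<le> D" by (simp add: D)
    ultimately have "D * (s * \<delta>)\<^sup>2 \<le> 4 * (real d)\<^sup>2"
      using mult_left_mono[of "(s * \<delta>)\<^sup>2" "(2 * max 1 r)\<^sup>2" D] by (simp add: power_mult_distrib)
    then show ?thesis by (simp add: power_mult_distrib mult_ac)
  qed
  have "s > 1" using r \<delta> by (simp add: s_def)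
  \<comment> \<open>For s \<le> d/2 the choice b = s/d keeps b \<le> 1/2, so 1 - b stays away from
    0. Otherwise d < 2 s, which makes \<delta>^2 D at most 16, and a single query is enough.\<close>
  have "\<delta>\<^sup>2 * D \<le> 48 * real q"
  proof (cases "s \<le> real d / 2")
    case True
    define b where "b = s / real d"
    have bd: "b * real d = s" using d by (simp add: b_def)
    have b: "0 < b" "b \<le> 1 / 2" using True d \<open>s > 1\<close> by (auto simp: b_def field_simps)
    have "\<epsilon> * real d powr recip_exponent p = \<delta> * (s - 1)"
      using \<delta> by (simp add: s_def r_def)
    also have "\<dots> \<le> (1 - \<epsilon>) * (s - 1)"
      using \<delta> \<open>s > 1\<close> by (intro mult_right_mono) auto
    finally have "(1 - b)\<^sup>2 \<le> 3 * b\<^sup>2 * real q"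
      using one_sided_tester_query_bound[OF d p \<epsilon>(1) \<open>\<epsilon> < 1\<close> tester, of b] b bd \<open>s > 1\<close> by simp
    moreover have "(1 / 2)\<^sup>2 \<le> (1 - b)\<^sup>2" using b by (intro power_mono) auto
    ultimately have "1 \<le> 12 * b\<^sup>2 * real q" by (simp add: power2_eq_square)
    then have "(real d)\<^sup>2 \<le> (12 * b\<^sup>2 * real q) * (real d)\<^sup>2"
      using mult_right_mono[of 1 _ "(real d)\<^sup>2"] by simp
    also have "\<dots> = 12 * s\<^sup>2 * real q" by (simp add: power_mult_distrib mult_ac flip: bd)
    finally have "s\<^sup>2 * (\<delta>\<^sup>2 * D) \<le> s\<^sup>2 * (48 * real q)"
      using \<open>s\<^sup>2 * D * \<delta>\<^sup>2 \<le> 4 * (real d)\<^sup>2\<close> by (simp add: mult_ac)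
    then show ?thesis using \<open>s > 1\<close> by (subst (asm) mult_le_cancel_left_pos) auto
  next
    case False
    then have "(real d)\<^sup>2 \<le> (2 * s)\<^sup>2" by (intro power_mono) auto
    then have "s\<^sup>2 * (\<delta>\<^sup>2 * D) \<le> s\<^sup>2 * 16"
      using \<open>s\<^sup>2 * D * \<delta>\<^sup>2 \<le> 4 * (real d)\<^sup>2\<close> by (simp add: mult_ac power_mult_distrib)
    then have "\<delta>\<^sup>2 * D \<le> 16" using \<open>s > 1\<close> by (subst (asm) mult_le_cancel_left_pos) auto
    moreover have "1 \<le> real q"
      using tester_makes_query[OF d p \<epsilon>(1) \<open>\<epsilon> < 1\<close> tester] by simp
    ultimately show ?thesis by simp
  qed
  then show "real q \<ge> (1 - \<epsilon>\<^sub>0)\<^sup>2 / 48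
      * min (1 / \<epsilon>\<^sup>2 * real d powr (2 - 2 * recip_exponent p)) ((real d)\<^sup>2)"
    by (simp add: \<delta>_def D_def)
qed

end
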